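(* There is an algorithm (a binary decision tree, each of whose inner nodes compares two of the six input integers by one of the relations $=,<,>,\le$) which, given positive integers $\delta_{0,1},\delta_{0,2},\delta_{1,2},\delta_{0,3},\delta_{1,3},\delta_{2,3}$ satisfying $\delta_{0,1}\ge\delta_{0,2}\ge\delta_{1,2}$, $\delta_{0,2}\ge\delta_{0,3}$ and $\delta_{0,2}\ge\delta_{1,3}$, correctly computes $\chi(\delta_{0,1},\delta_{0,2},\delta_{1,2},\delta_{0,3},\delta_{1,3},\delta_{2,3})$ using at most $6$ integer comparisons on every input.
   Context: Put $\delta_{j,i}=\delta_{i,j}$. The canonicity function $\chi(\delta_{0,1},\delta_{0,2},\delta_{1,2},\delta_{0,3},\delta_{1,3},\delta_{2,3})\in\{true,false\}$ is $true$ if and only if $$(\delta_{0,1},\delta_{0,2},\delta_{1,2},\delta_{0,3},\delta_{1,3},\delta_{2,3})\succeq(\delta_{\tau(0),\tau(1)},\delta_{\tau(0),\tau(2)},\delta_{\tau(1),\tau(2)},\delta_{\tau(0),\tau(3)},\delta_{\tau(1),\tau(3)},\delta_{\tau(2),\tau(3)})$$ for all permutations $\tau$ of $\{0,1,2,3\}$, where $\succeq$ denotes the lexicographic order on integer vectors. *)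

theory Defs
  imports "HOL-Combinatorics.Permutations" "HOL-Library.Product_Lexorder"
begin

type_synonym sextuple = "int \<times> int \<times> int \<times> int \<times> int \<times> int"

text \<open>Components are listed in the order 01, 02, 12, 03, 13, 23. The indices \<open>i\<close>, \<open>j\<close> enter only
  through the set \<open>{i, j}\<close>, which gives the convention \<open>\<delta>\<^sub>j\<^sub>i = \<delta>\<^sub>i\<^sub>j\<close>; the value \<open>0\<close> for other index
  pairs is a dummy that is never used below.\<close>
fun delta :: "sextuple \<Rightarrow> nat \<Rightarrow> nat \<Rightarrow> int" where
  "delta (d01, d02, d12, d03, d13, d23) i j =
    (if {i, j} = {0, 1} then d01
     else if {i, j} = {0, 2} then d02
     else if {i, j} = {1, 2} then d12
     else if {i, j} = {0, 3} then d03
     else if {i, j} = {1, 3} then d13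
     else if {i, j} = {2, 3} then d23
     else 0)"

text \<open>The order on tuples is the lexicographic one, by the instance in
  \<^theory>\<open>HOL-Library.Product_Lexorder\<close>.\<close>
definition chi :: "sextuple \<Rightarrow> bool" where
  "chi x \<longleftrightarrow> (\<forall>\<tau>. \<tau> permutes {0, 1, 2, 3} \<longrightarrow>
     x \<ge> (delta x (\<tau> 0) (\<tau> 1), delta x (\<tau> 0) (\<tau> 2), delta x (\<tau> 1) (\<tau> 2),
          delta x (\<tau> 0) (\<tau> 3), delta x (\<tau> 1) (\<tau> 3), delta x (\<tau> 2) (\<tau> 3)))"

datatype entry = E01 | E02 | E12 | E03 | E13 | E23

fun entry_val :: "sextuple \<Rightarrow> entry \<Rightarrow> int" where
  "entry_val (d01, d02, d12, d03, d13, d23) e =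
    (case e of E01 \<Rightarrow> d01 | E02 \<Rightarrow> d02 | E12 \<Rightarrow> d12 | E03 \<Rightarrow> d03 | E13 \<Rightarrow> d13 | E23 \<Rightarrow> d23)"

datatype comparison = Cmp_eq | Cmp_less | Cmp_greater | Cmp_le

primrec holds :: "comparison \<Rightarrow> int \<Rightarrow> int \<Rightarrow> bool" where
  "holds Cmp_eq a b \<longleftrightarrow> a = b"
| "holds Cmp_less a b \<longleftrightarrow> a < b"
| "holds Cmp_greater a b \<longleftrightarrow> a > b"
| "holds Cmp_le a b \<longleftrightarrow> a \<le> b"

text \<open>In \<open>Compare c e f t u\<close>, the subtree \<open>t\<close> is entered if the comparison holds, and \<open>u\<close> otherwise.\<close>
datatype decision_tree =
    Answer bool
  | Compare comparison entry entry decision_tree decision_tree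

text \<open>Every inner node compares two different inputs.\<close>
primrec well_formed :: "decision_tree \<Rightarrow> bool" where
  "well_formed (Answer b) \<longleftrightarrow> True"
| "well_formed (Compare c e f t u) \<longleftrightarrow> e \<noteq> f \<and> well_formed t \<and> well_formed u"

primrec run :: "decision_tree \<Rightarrow> sextuple \<Rightarrow> bool" where
  "run (Answer b) x = b"
| "run (Compare c e f t u) x =
    (if holds c (entry_val x e) (entry_val x f) then run t x else run u x)"

primrec comparisons :: "decision_tree \<Rightarrow> sextuple \<Rightarrow> nat" where
  "comparisons (Answer b) x = 0"
| "comparisons (Compare c e f t u) x =
    Suc (if holds c (entry_val x e) (entry_val x f) then comparisons t x else comparisons u x)"

end

theory Submission
  imports Defs
begin

text \<open>
  View the input as edge weights of the complete graph on \<open>{0, 1, 2, 3}\<close>. The assumptions already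
  decide most of the \<open>24\<close> comparisons with relabelled tuples. Once \<open>d23 \<le> d01\<close> is known, \<open>d01\<close> is a
  largest weight, and a relabelling can only exceed the original tuple if it ties with it in the
  first two positions. All such ties are controlled by the relabellings \<open>(2 3)\<close>, \<open>(1 2)\<close>,
  \<open>(0 1)\<close>, \<open>(0 1)(2 3)\<close> and \<open>(0 2)(1 3)\<close>. Each of these five contributes one conditional
  inequality, and the last one also \<open>d23 \<le> d01\<close> itself; their conjunction is \<open>tie_conditions\<close>, and
  lemma \<open>chi_iff_tie_conditions\<close> shows that it is equivalent to canonicity.

  Testing the six conjuncts one after the other would take up to eleven comparisons. Six are
  enough because \<open>d02\<close> bounds \<open>d12\<close>, \<open>d03\<close> and \<open>d13\<close>: a strict inequality between two of these
  three excludes that the smaller one ties with \<open>d02\<close>, so that a single comparison settles the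
  premise of one condition and the conclusion of another. After testing \<open>d23 \<le> d01\<close> and
  \<open>d01 = d02\<close>, the lemmas \<open>run_equal_branch\<close> and \<open>run_greater_branch\<close> exploit this
  for \<open>d12 < d13\<close> and for \<open>d12 < d03\<close>, respectively.
\<close>

text \<open>The conditional inequalities are, in this order, what remains of the comparisons with the
  relabellings \<open>(0 2)(1 3)\<close>, \<open>(2 3)\<close>, \<open>(1 2)\<close>, \<open>(0 1)\<close> and \<open>(0 1)(2 3)\<close>.\<close>
definition tie_conditions :: "int \<Rightarrow> int \<Rightarrow> int \<Rightarrow> int \<Rightarrow> int \<Rightarrow> int \<Rightarrow> bool" where
  "tie_conditions d01 d02 d12 d03 d13 d23 \<longleftrightarrow>
     d23 \<le> d01 \<and>
     (d01 = d23 \<longrightarrow> d03 \<le> d12) \<and>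
     (d02 = d03 \<longrightarrow> d13 \<le> d12) \<and>
     (d01 = d02 \<longrightarrow> d23 \<le> d13) \<and>
     (d02 = d12 \<longrightarrow> d13 \<le> d03) \<and>
     (d02 = d13 \<longrightarrow> d03 \<le> d12)"

definition relabel :: "sextuple \<Rightarrow> nat \<Rightarrow> nat \<Rightarrow> nat \<Rightarrow> nat \<Rightarrow> sextuple" where
  "relabel x a b c e =
     (delta x a b, delta x a c, delta x b c, delta x a e, delta x b e, delta x c e)"

text \<open>The edge that the relabelling moves to position 01 weighs at most \<open>d01\<close>. If it weighs exactly
  \<open>d01\<close>, then the edge moved to position 02 weighs at most \<open>d02\<close>: otherwise it would have to be the
  edge 01 or 23, hence the leading edge is one of its four neighbours, so \<open>d02 = d01\<close> is a largest weight,
  a contradiction. The implications in \<open>tie_conditions\<close> handle the ties in both positions.\<close>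
lemma tie_conditions_imp_relabel_le:
  assumes "d01 \<ge> d02" "d02 \<ge> d12" "d02 \<ge> d03" "d02 \<ge> d13"
    and "tie_conditions d01 d02 d12 d03 d13 d23"
    and "{a, b, c, e} \<subseteq> {0, 1, 2, 3}" "distinct [a, b, c, e]"
  shows "relabel (d01, d02, d12, d03, d13, d23) a b c e \<le> (d01, d02, d12, d03, d13, d23)"
proof -
  have "a = 0 \<or> a = 1 \<or> a = 2 \<or> a = 3" "b = 0 \<or> b = 1 \<or> b = 2 \<or> b = 3"
    "c = 0 \<or> c = 1 \<or> c = 2 \<or> c = 3" "e = 0 \<or> e = 1 \<or> e = 2 \<or> e = 3"
    using assms(6) by auto
  then show ?thesis
    using assms(1-5,7) unfolding tie_conditions_def
    by (elim disjE; simp add: relabel_def doubleton_eq_iff; smt)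
qed

lemma chi_imp_relabel_le:
  assumes "chi x" and "\<tau> permutes {0, 1, 2, 3}"
  shows "relabel x (\<tau> 0) (\<tau> 1) (\<tau> 2) (\<tau> 3) \<le> x"
  using assms unfolding chi_def relabel_def by blast

lemma chi_imp_tie_conditions:
  assumes "chi (d01, d02, d12, d03, d13, d23)"
  shows "tie_conditions d01 d02 d12 d03 d13 d23"
proof -
  let ?x = "(d01, d02, d12, d03, d13, d23)"
  let ?S = "{0, 1, 2, 3} :: nat set"
  have perms: "transpose 2 3 permutes ?S" "transpose 1 2 permutes ?S" "transpose 0 1 permutes ?S"
      "transpose 0 1 \<circ> transpose 2 3 permutes ?S" "transpose 0 2 \<circ> transpose 1 3 permutes ?S"
    by (auto intro!: permutes_compose permutes_swap_id)
  have "relabel ?x 0 1 3 2 \<le> ?x"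
    using chi_imp_relabel_le[OF assms perms(1)] by (simp add: transpose_def)
  moreover have "relabel ?x 0 2 1 3 \<le> ?x"
    using chi_imp_relabel_le[OF assms perms(2)] by (simp add: transpose_def)
  moreover have "relabel ?x 1 0 2 3 \<le> ?x"
    using chi_imp_relabel_le[OF assms perms(3)] by (simp add: transpose_def)
  moreover have "relabel ?x 1 0 3 2 \<le> ?x"
    using chi_imp_relabel_le[OF assms perms(4)] by (simp add: transpose_def)
  moreover have "relabel ?x 2 3 0 1 \<le> ?x"
    using chi_imp_relabel_le[OF assms perms(5)] by (simp add: transpose_def)
  ultimately show ?thesis
    unfolding tie_conditions_def relabel_def by (simp add: doubleton_eq_iff; smt)
qed

lemma chi_iff_tie_conditions:
  assumes "d01 \<ge> d02" "d02 \<ge> d12" "d02 \<ge> d03" "d02 \<ge> d13"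
  shows "chi (d01, d02, d12, d03, d13, d23) \<longleftrightarrow> tie_conditions d01 d02 d12 d03 d13 d23"
proof
  assume tie: "tie_conditions d01 d02 d12 d03 d13 d23"
  show "chi (d01, d02, d12, d03, d13, d23)"
    unfolding chi_def relabel_def[symmetric]
  proof (intro allI impI)
    fix \<tau> :: "nat \<Rightarrow> nat"
    assume \<tau>: "\<tau> permutes {0, 1, 2, 3}"
    have "distinct [\<tau> 0, \<tau> 1, \<tau> 2, \<tau> 3]"
      using permutes_inj[OF \<tau>] by (simp add: inj_eq)
    moreover have "{\<tau> 0, \<tau> 1, \<tau> 2, \<tau> 3} \<subseteq> {0, 1, 2, 3}"
      using permutes_image[OF \<tau>] by auto
    ultimately show "relabel (d01, d02, d12, d03, d13, d23) (\<tau> 0) (\<tau> 1) (\<tau> 2) (\<tau> 3)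
        \<le> (d01, d02, d12, d03, d13, d23)"
      by (intro tie_conditions_imp_relabel_le[OF assms tie])
  qed
qed (rule chi_imp_tie_conditions)

definition equal_branch :: decision_tree where
  "equal_branch =
     Compare Cmp_less E13 E23
       (Answer False)
       (Compare Cmp_less E12 E13
         (Compare Cmp_eq E01 E13
           (Compare Cmp_less E12 E03 (Answer False) (Answer True))
           (Compare Cmp_eq E01 E03 (Answer False) (Answer True)))
         (Compare Cmp_eq E01 E12
           (Compare Cmp_less E03 E13 (Answer False) (Answer True))
           (Answer True)))"

definition greater_branch :: decision_tree where
  "greater_branch =
     Compare Cmp_less E12 E03
       (Compare Cmp_eq E01 E23
         (Answer False)
         (Compare Cmp_eq E02 E03
           (Compare Cmp_less E12 E13 (Answer False) (Answer True))
           (Compare Cmp_eq E02 E13 (Answer False) (Answer True))))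
       (Compare Cmp_less E03 E13
         (Compare Cmp_eq E02 E12 (Answer False) (Answer True))
         (Answer True))"

definition canonicity_tree :: decision_tree where
  "canonicity_tree =
     Compare Cmp_less E01 E23
       (Answer False)
       (Compare Cmp_eq E01 E02 equal_branch greater_branch)"

text \<open>Since \<open>d23 \<le> d13\<close> is required here, a tie \<open>d01 = d23\<close> forces \<open>d02 = d13\<close>, so its condition
  is implied by that of \<open>d02 = d13\<close>. If \<open>d12 < d13\<close>, then \<open>d12 < d02\<close>, the condition on \<open>d02 = d12\<close>
  is void, and \<open>d02 \<noteq> d03\<close> is required; in the case \<open>d02 = d13\<close> this follows from the inequality
  \<open>d03 \<le> d12\<close>, which is required there. If \<open>d13 \<le> d12\<close>, a tie \<open>d02 = d13\<close> makes \<open>d12\<close> equal to \<open>d02\<close>, so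
  that \<open>d03 \<le> d12\<close>, and only the condition on \<open>d02 = d12\<close> is left.\<close>
lemma run_equal_branch:
  assumes "d01 = d02" "d02 \<ge> d12" "d02 \<ge> d03" "d02 \<ge> d13" "d23 \<le> d01"
  shows "run equal_branch (d01, d02, d12, d03, d13, d23) \<longleftrightarrow>
    tie_conditions d01 d02 d12 d03 d13 d23"
  using assms unfolding equal_branch_def tie_conditions_def by (simp; smt)

text \<open>If \<open>d12 < d03\<close>, then \<open>d12 < d02\<close>, the condition on \<open>d02 = d12\<close> is void, and neither
  \<open>d01 = d23\<close> nor \<open>d02 = d13\<close> may hold; in the case \<open>d02 = d03\<close> the latter follows from the inequality
  \<open>d13 \<le> d12\<close>, which is required there. If \<open>d03 \<le> d12\<close>, a tie \<open>d02 = d03\<close> makes \<open>d12\<close> equal to \<open>d02\<close>, so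
  that \<open>d13 \<le> d12\<close>, and only the condition on \<open>d02 = d12\<close> is left.\<close>
lemma run_greater_branch:
  assumes "d01 > d02" "d02 \<ge> d12" "d02 \<ge> d03" "d02 \<ge> d13" "d23 \<le> d01"
  shows "run greater_branch (d01, d02, d12, d03, d13, d23) \<longleftrightarrow>
    tie_conditions d01 d02 d12 d03 d13 d23"
  using assms unfolding greater_branch_def tie_conditions_def by (simp; smt)

lemma run_canonicity_tree:
  assumes "d01 \<ge> d02" "d02 \<ge> d12" "d02 \<ge> d03" "d02 \<ge> d13"
  shows "run canonicity_tree (d01, d02, d12, d03, d13, d23) \<longleftrightarrow>
    tie_conditions d01 d02 d12 d03 d13 d23"
proof (cases "d01 < d23")
  case True
  then show ?thesis by (simp add: canonicity_tree_def tie_conditions_def)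
next
  case False
  then show ?thesis
    using assms run_equal_branch run_greater_branch by (simp add: canonicity_tree_def)
qed

theorem mainTheorem4:
  shows "\<exists>T. well_formed T \<and>
    (\<forall>d01 d02 d12 d03 d13 d23 :: int.
       d01 > 0 \<and> d02 > 0 \<and> d12 > 0 \<and> d03 > 0 \<and> d13 > 0 \<and> d23 > 0 \<and>
       d01 \<ge> d02 \<and> d02 \<ge> d12 \<and> d02 \<ge> d03 \<and> d02 \<ge> d13 \<longrightarrow>
       run T (d01, d02, d12, d03, d13, d23) = chi (d01, d02, d12, d03, d13, d23) \<and>
       comparisons T (d01, d02, d12, d03, d13, d23) \<le> 6)"
proof (intro exI[of _ canonicity_tree] conjI allI impI)
  show "well_formed canonicity_tree"
    by (simp add: canonicity_tree_def equal_branch_def greater_branch_def)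
next
  fix d01 d02 d12 d03 d13 d23 :: int
  assume "d01 > 0 \<and> d02 > 0 \<and> d12 > 0 \<and> d03 > 0 \<and> d13 > 0 \<and> d23 > 0 \<and>
    d01 \<ge> d02 \<and> d02 \<ge> d12 \<and> d02 \<ge> d03 \<and> d02 \<ge> d13"
  then show "run canonicity_tree (d01, d02, d12, d03, d13, d23) =
      chi (d01, d02, d12, d03, d13, d23)"
    by (simp only: run_canonicity_tree chi_iff_tie_conditions)
next
  fix d01 d02 d12 d03 d13 d23 :: int
  show "comparisons canonicity_tree (d01, d02, d12, d03, d13, d23) \<le> 6"
    by (simp add: canonicity_tree_def equal_branch_def greater_branch_def)
qed

end
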